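(* Let $X$ be a finite simplicial complex with vertices $v_1,\dots,v_m$ and let $\varepsilon\in\mathbb{Z}_2^m$ with $\varepsilon\neq(0,\dots,0)$. Then the subgraph $I(X,\varepsilon)$ of the face poset $\mathcal{P}(X)$ is a discrete Morse matching if and only if $\varepsilon$ is dalmatian.
   Context: $\mathbb{F}$ is the field with two elements. A colouring $\varepsilon\in\mathbb{Z}_2^m$ colours $v_i$ black if $\varepsilon(i)=1$ and white otherwise. The horizontal differential $\partial_h$ on the simplicial chain complex $C_*(X)$ over $\mathbb{F}$ sends a simplex $\sigma$ to the sum of the faces $\sigma\setminus\{v\}$ over the black vertices $v$ of $\sigma$. The face poset $\mathcal{P}(X)$ is the directed graph whose vertices are the nonempty simplices of $X$, with an edge from $\sigma$ to $\tau$ whenever $\tau\subset\sigma$ and $\dim\tau=\dim\sigma-1$. $I(X,\varepsilon)$ is the subgraph of $\mathcal{P}(X)$ consisting of the edges $\sigma\to\tau$ such that $\tau$ appears with nonzero coefficient in $\partial_h(\sigma)$. A matching on a graph is a set of pairwise disjoint edges (no two sharing an endpoint); a matching on $\mathcal{P}(X)$ is a (discrete) Morse matching if reversing the orientation of its edges creates no directed cycle in $\mathcal{P}(X)$. A colouring $\varepsilon\neq(0,\dots,0)$ is dalmatian if for every pair of simplices $\sigma,\tau$ of $X$ with $\sigma\cap\tau\neq\emptyset$, the vertex set of $\sigma\cup\tau$ contains at most one black vertex (equivalently, the closed stars of the black vertices are pairwise disjoint). *)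

theory Defs
  imports
    "HOL-Analysis.Finite_Cartesian_Product"
    "HOL-Library.Poly_Mapping"
    "HOL-Library.Z2"
    "Graph_Theory.Pair_Digraph"
begin

section \<open>Finite simplicial complexes and colourings\<close>

text \<open>
  The empty set counts as a simplex of every nonempty complex (of dimension \<open>-1\<close>); chains and
  the face poset use the nonempty simplices only.
\<close>

definition finite_simplicial_complex :: "'a set set \<Rightarrow> bool" where
  "finite_simplicial_complex X \<longleftrightarrow>
     finite X \<and> (\<forall>\<sigma>\<in>X. finite \<sigma>) \<and> (\<forall>\<sigma>\<in>X. \<forall>\<tau>. \<tau> \<subseteq> \<sigma> \<longrightarrow> \<tau> \<in> X)"

definition vertices :: "'a set set \<Rightarrow> 'a set" where
  "vertices X = \<Union>X"

definition nonempty_simplices :: "'a set set \<Rightarrow> 'a set set" where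
  "nonempty_simplices X = X - {{}}"

definition simplex_dim :: "'a set \<Rightarrow> int" where
  "simplex_dim \<sigma> = int (card \<sigma>) - 1"

text \<open>
  The \<open>m\<close> vertices are enumerated by an injective map \<open>v\<close> from a finite index type with
  \<open>m\<close> elements, so a colouring in \<open>(\<int>/2)\<^sup>m\<close> is a vector of type \<open>bit ^ 'n\<close>.
\<close>

definition black :: "('n::finite \<Rightarrow> 'a) \<Rightarrow> bit ^ 'n \<Rightarrow> 'a set" where
  "black v \<epsilon> = {v i | i. \<epsilon> $ i = 1}"

definition dalmatian :: "'a set set \<Rightarrow> ('n::finite \<Rightarrow> 'a) \<Rightarrow> bit ^ 'n \<Rightarrow> bool" where
  "dalmatian X v \<epsilon> \<longleftrightarrow>
     \<epsilon> \<noteq> 0 \<and>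
     (\<forall>\<sigma>\<in>X. \<forall>\<tau>\<in>X. \<sigma> \<inter> \<tau> \<noteq> {} \<longrightarrow> card ((\<sigma> \<union> \<tau>) \<inter> black v \<epsilon>) \<le> 1)"

section \<open>The horizontal differential\<close>

text \<open>
  Chains over the field with two elements are finitely supported \<open>bit\<close>-valued functions on sets
  of vertices; \<open>chains X\<close> is the direct sum of the chain groups over all dimensions \<open>\<ge> 0\<close>.
  The complex is not augmented: the empty face of a single vertex does not contribute.
\<close>

definition chains :: "'a set set \<Rightarrow> ('a set \<Rightarrow>\<^sub>0 bit) set" where
  "chains X = {c. Poly_Mapping.keys c \<subseteq> nonempty_simplices X}"

definition simplex_chain :: "'a set \<Rightarrow> ('a set \<Rightarrow>\<^sub>0 bit)" where
  "simplex_chain \<sigma> = Poly_Mapping.single \<sigma> 1"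

definition simplex_horizontal_boundary ::
    "('n::finite \<Rightarrow> 'a) \<Rightarrow> bit ^ 'n \<Rightarrow> 'a set \<Rightarrow> ('a set \<Rightarrow>\<^sub>0 bit)" where
  "simplex_horizontal_boundary v \<epsilon> \<sigma> =
     (\<Sum>x \<in> {x \<in> \<sigma> \<inter> black v \<epsilon>. \<sigma> - {x} \<noteq> {}}. simplex_chain (\<sigma> - {x}))"

definition horizontal_boundary ::
    "('n::finite \<Rightarrow> 'a) \<Rightarrow> bit ^ 'n \<Rightarrow> ('a set \<Rightarrow>\<^sub>0 bit) \<Rightarrow> ('a set \<Rightarrow>\<^sub>0 bit)" where
  "horizontal_boundary v \<epsilon> c =
     (\<Sum>\<sigma> \<in> Poly_Mapping.keys c. Poly_Mapping.map ((*) (Poly_Mapping.lookup c \<sigma>)) (simplex_horizontal_boundary v \<epsilon> \<sigma>))"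

lemma horizontal_boundary_simplex_chain:
  "horizontal_boundary v \<epsilon> (simplex_chain \<sigma>) = simplex_horizontal_boundary v \<epsilon> \<sigma>"
proof -
  have "Poly_Mapping.map ((*) 1) c = c" for c :: "'a set \<Rightarrow>\<^sub>0 bit"
    by (rule poly_mapping_eqI) (simp add: Poly_Mapping.map.rep_eq when_def split: if_splits)
  then show ?thesis
    by (simp add: horizontal_boundary_def simplex_chain_def)
qed

lemma horizontal_boundary_in_chains:
  assumes X: "finite_simplicial_complex X" and c: "c \<in> chains X"
  shows "horizontal_boundary v \<epsilon> c \<in> chains X"
proof -
  have sub: "Poly_Mapping.keys (Poly_Mapping.map f d) \<subseteq> Poly_Mapping.keys d" for f and d :: "'a set \<Rightarrow>\<^sub>0 bit"
    by (auto simp: in_keys_iff Poly_Mapping.map.rep_eq when_def split: if_splits)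
  have s: "Poly_Mapping.keys (simplex_horizontal_boundary v \<epsilon> \<sigma>) \<subseteq> nonempty_simplices X" if "\<sigma> \<in> Poly_Mapping.keys c" for \<sigma>
  proof -
    have "\<sigma> \<in> X" using that c by (auto simp: chains_def nonempty_simplices_def)
    then have *: "\<sigma> - {x} \<in> X" for x
      using X unfolding finite_simplicial_complex_def by blast
    show ?thesis
      unfolding simplex_horizontal_boundary_def
      by (rule order_trans[OF keys_sum])
        (use * in \<open>auto simp: simplex_chain_def nonempty_simplices_def\<close>)
  qed
  have "Poly_Mapping.keys (horizontal_boundary v \<epsilon> c) \<subseteq> nonempty_simplices X"
    unfolding horizontal_boundary_def
    by (rule order_trans[OF keys_sum]) (use s sub in blast)
  then show ?thesis by (simp add: chains_def)
qed

section \<open>The face poset and discrete Morse matchings\<close>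

definition face_poset :: "'a set set \<Rightarrow> 'a set pair_pre_digraph" where
  "face_poset X =
     \<lparr> pverts = nonempty_simplices X,
       parcs = {(\<sigma>, \<tau>). \<sigma> \<in> nonempty_simplices X \<and> \<tau> \<in> nonempty_simplices X \<and>
                        \<tau> \<subset> \<sigma> \<and> simplex_dim \<tau> = simplex_dim \<sigma> - 1} \<rparr>"

text \<open>The subgraph \<open>I(X, \<epsilon>)\<close> of the face poset, given by its set of edges.\<close>

definition horizontal_arcs ::
    "'a set set \<Rightarrow> ('n::finite \<Rightarrow> 'a) \<Rightarrow> bit ^ 'n \<Rightarrow> ('a set \<times> 'a set) set" where
  "horizontal_arcs X v \<epsilon> =
     {(\<sigma>, \<tau>) \<in> parcs (face_poset X).
        Poly_Mapping.lookup (horizontal_boundary v \<epsilon> (simplex_chain \<sigma>)) \<tau> \<noteq> 0}"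

definition is_matching :: "'b pair_pre_digraph \<Rightarrow> ('b \<times> 'b) set \<Rightarrow> bool" where
  "is_matching G M \<longleftrightarrow>
     M \<subseteq> parcs G \<and>
     (\<forall>e\<in>M. \<forall>f\<in>M. e \<noteq> f \<longrightarrow> {fst e, snd e} \<inter> {fst f, snd f} = {})"

definition reverse_arcs :: "'b pair_pre_digraph \<Rightarrow> ('b \<times> 'b) set \<Rightarrow> 'b pair_pre_digraph" where
  "reverse_arcs G M = \<lparr> pverts = pverts G, parcs = (parcs G - M) \<union> M\<inverse> \<rparr>"

definition morse_matching :: "'a set set \<Rightarrow> ('a set \<times> 'a set) set \<Rightarrow> bool" where
  "morse_matching X M \<longleftrightarrow>
     is_matching (face_poset X) M \<and>
     (\<nexists>p. pre_digraph.cycle (with_proj (reverse_arcs (face_poset X) M)) p)"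

end

theory Submission
  imports Defs
begin

text \<open>
  The edges of \<open>I(X, \<epsilon>)\<close> are \<open>\<sigma> \<rightarrow> \<sigma> \<setminus> {b}\<close> with \<open>b\<close> black. Two of them
  sharing an endpoint remove black vertices of simplices that meet, so in the dalmatian case the same
  vertex, and then they coincide. Conversely two black vertices \<open>b\<close>, \<open>c\<close> whose closed stars share
  a vertex \<open>w\<close> either span a simplex, from which edges lead to \<open>{b}\<close> and to \<open>{c}\<close>, or give two
  edges from \<open>{b, w}\<close> and \<open>{c, w}\<close> to \<open>{w}\<close>. The acyclicity is automatic for every colouring: after
  the reversal each edge either adds a black vertex or removes a white one.
\<close>

text \<open>Since \<open>f\<close> is integer-valued, a strict drop costs at least 1, so these costs
  add up along the walk to at least its length.\<close>

lemma cas_potential_le: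
  fixes f :: "'b \<Rightarrow> int"
  assumes "pre_digraph.cas G u p w" and "set p \<subseteq> arcs G"
    and dec: "\<And>e. e \<in> arcs G \<Longrightarrow> f (head G e) < f (tail G e)"
  shows "f w + int (length p) \<le> f u"
  using assms(1,2)
proof (induction p arbitrary: u)
  case Nil
  then show ?case by (simp add: pre_digraph.cas.simps)
next
  case (Cons e p)
  then have "tail G e = u" "f w + int (length p) \<le> f (head G e)"
    by (auto simp: pre_digraph.cas.simps)
  then show ?case using dec[of e] Cons.prems by auto
qed

text \<open>A cycle is a nonempty closed walk, and the preceding bound with equal endpoints would
  force its length to be at most 0.\<close>

lemma no_cycle_if_potential:
  fixes f :: "'b \<Rightarrow> int"
  assumes "\<And>e. e \<in> arcs G \<Longrightarrow> f (head G e) < f (tail G e)"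
  shows "\<not> pre_digraph.cycle G p"
proof
  assume "pre_digraph.cycle G p"
  then obtain u where "pre_digraph.cas G u p u" "set p \<subseteq> arcs G" "p \<noteq> []"
    by (auto simp: pre_digraph.cycle_def pre_digraph.awalk_def)
  then show False
    using cas_potential_le[of G u p u f] assms by fastforce
qed

text \<open>Deleting different vertices of \<sigma> gives different faces, so no two terms of the
  sum cancel modulo 2.\<close>

lemma lookup_simplex_horizontal_boundary:
  "Poly_Mapping.lookup (simplex_horizontal_boundary v \<epsilon> \<sigma>) \<tau> \<noteq> 0 \<longleftrightarrow>
     \<tau> \<noteq> {} \<and> (\<exists>b \<in> \<sigma> \<inter> black v \<epsilon>. \<tau> = \<sigma> - {b})"
proof -
  let ?B = "{x \<in> \<sigma> \<inter> black v \<epsilon>. \<sigma> - {x} \<noteq> {}}"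
  \<comment> \<open>Here \<sigma> may be infinite; finiteness comes from the finite index type
    behind \<open>black\<close>.\<close>
  have fin: "finite ?B"
    by (simp add: black_def)
  have *: "Poly_Mapping.lookup (simplex_horizontal_boundary v \<epsilon> \<sigma>) \<tau> =
      (\<Sum>x\<in>?B. if \<sigma> - {x} = \<tau> then 1 else 0)"
    unfolding simplex_horizontal_boundary_def simplex_chain_def lookup_sum
    by (simp add: lookup_single when_def)
  show ?thesis
  proof (cases "\<exists>b \<in> ?B. \<tau> = \<sigma> - {b}")
    case True
    then obtain b where b: "b \<in> ?B" "\<tau> = \<sigma> - {b}" by blast
    then have "\<sigma> - {x} = \<tau> \<longleftrightarrow> x = b" if "x \<in> ?B" for x
      using that by blast
    then have "(\<Sum>x\<in>?B. if \<sigma> - {x} = \<tau> then 1 else 0) = (\<Sum>x\<in>?B. if x = b then 1 else (0::bit))"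
      by (intro sum.cong) auto
    also have "\<dots> = 1"
      using b fin by (subst sum.delta) auto
    finally show ?thesis using * b by auto
  next
    case False
    then have "(\<Sum>x\<in>?B. if \<sigma> - {x} = \<tau> then 1 else (0::bit)) = 0"
      by (intro sum.neutral) auto
    then show ?thesis using * False by auto
  qed
qed

text \<open>For finite sets, codimension one means that the difference is a singleton; conversely,
  closure under subsets puts the smaller set in \<open>X\<close>.\<close>

lemma face_poset_arcs_iff:
  assumes "finite_simplicial_complex X"
  shows "(\<sigma>, \<tau>) \<in> parcs (face_poset X) \<longleftrightarrow>
    \<sigma> \<in> X \<and> \<tau> \<noteq> {} \<and> (\<exists>x \<in> \<sigma>. \<tau> = \<sigma> - {x})"
proof
  assume "(\<sigma>, \<tau>) \<in> parcs (face_poset X)"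
  then have a: "\<sigma> \<in> X" "\<tau> \<noteq> {}" "\<tau> \<subset> \<sigma>" "card \<sigma> = Suc (card \<tau>)"
    by (auto simp: face_poset_def nonempty_simplices_def simplex_dim_def)
  then have "finite \<sigma>"
    using assms by (auto simp: finite_simplicial_complex_def)
  then have "card (\<sigma> - \<tau>) = 1"
    using a finite_subset[of \<tau> \<sigma>] by (simp add: card_Diff_subset psubset_imp_subset)
  then obtain x where "\<sigma> - \<tau> = {x}"
    by (auto simp: card_1_singleton_iff)
  then show "\<sigma> \<in> X \<and> \<tau> \<noteq> {} \<and> (\<exists>x \<in> \<sigma>. \<tau> = \<sigma> - {x})"
    using a by blast
next
  assume "\<sigma> \<in> X \<and> \<tau> \<noteq> {} \<and> (\<exists>x \<in> \<sigma>. \<tau> = \<sigma> - {x})"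
  then obtain x where x: "\<sigma> \<in> X" "\<tau> \<noteq> {}" "x \<in> \<sigma>" "\<tau> = \<sigma> - {x}" by blast
  then have "finite \<sigma>" "\<tau> \<in> X"
    using assms by (auto simp: finite_simplicial_complex_def)
  moreover from this x have "card \<sigma> = Suc (card \<tau>)"
    using card.remove[of \<sigma> x] by blast
  ultimately show "(\<sigma>, \<tau>) \<in> parcs (face_poset X)"
    using x by (auto simp: face_poset_def nonempty_simplices_def simplex_dim_def)
qed

lemma horizontal_arcs_iff:
  assumes "finite_simplicial_complex X"
  shows "(\<sigma>, \<tau>) \<in> horizontal_arcs X v \<epsilon> \<longleftrightarrow>
    \<sigma> \<in> X \<and> \<tau> \<noteq> {} \<and> (\<exists>b \<in> \<sigma> \<inter> black v \<epsilon>. \<tau> = \<sigma> - {b})"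
  using face_poset_arcs_iff[OF assms]
  by (auto simp: horizontal_arcs_def horizontal_boundary_simplex_chain
      lookup_simplex_horizontal_boundary simp del: bit_not_zero_iff)

lemma reverse_horizontal_arcs_acyclic:
  assumes X: "finite_simplicial_complex X"
  shows "\<not> pre_digraph.cycle (with_proj (reverse_arcs (face_poset X) (horizontal_arcs X v \<epsilon>))) p"
proof -
  let ?M = "horizontal_arcs X v \<epsilon>"
  let ?B = "black v \<epsilon>"
  \<comment> \<open>White minus black vertices: deleting a white vertex and adding a black one both
    lower this number by one.\<close>
  define f where "f \<sigma> = int (card (\<sigma> - ?B)) - int (card (\<sigma> \<inter> ?B))" for \<sigma>
  have fin: "finite \<sigma>" if "\<sigma> \<in> X" for \<sigma>
    using that X by (auto simp: finite_simplicial_complex_def)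
  have up: "f \<sigma> < f (\<sigma> - {b})" if "\<sigma> \<in> X" "b \<in> \<sigma> \<inter> ?B" for \<sigma> b
  proof -
    have "\<sigma> - {b} - ?B = \<sigma> - ?B" "(\<sigma> - {b}) \<inter> ?B = \<sigma> \<inter> ?B - {b}"
      using that by auto
    moreover have "card (\<sigma> \<inter> ?B) = Suc (card (\<sigma> \<inter> ?B - {b}))"
      using that fin by (intro card.remove) auto
    ultimately show ?thesis by (simp add: f_def)
  qed
  have down: "f (\<sigma> - {x}) < f \<sigma>" if "\<sigma> \<in> X" "x \<in> \<sigma> - ?B" for \<sigma> x
  proof -
    have "(\<sigma> - {x}) \<inter> ?B = \<sigma> \<inter> ?B" "\<sigma> - {x} - ?B = \<sigma> - ?B - {x}"
      using that by auto
    moreover have "card (\<sigma> - ?B) = Suc (card (\<sigma> - ?B - {x}))"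
      using that fin by (intro card.remove) auto
    ultimately show ?thesis by (simp add: f_def)
  qed
  have "f \<tau> < f \<sigma>" if "(\<sigma>, \<tau>) \<in> parcs (reverse_arcs (face_poset X) ?M)" for \<sigma> \<tau>
  proof -
    have "parcs (reverse_arcs (face_poset X) ?M) = (parcs (face_poset X) - ?M) \<union> ?M\<inverse>"
      by (simp add: reverse_arcs_def)
    with that consider "(\<sigma>, \<tau>) \<in> parcs (face_poset X)" "(\<sigma>, \<tau>) \<notin> ?M" | "(\<tau>, \<sigma>) \<in> ?M"
      by blast
    then show ?thesis
    proof cases
      case 1
      \<comment> \<open>The deleted vertex is white, since deleting a black one would put the arc in
        \<open>?M\<close>.\<close>
      then obtain x where "\<sigma> \<in> X" "x \<in> \<sigma> - ?B" "\<tau> = \<sigma> - {x}"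
        unfolding horizontal_arcs_iff[OF X] face_poset_arcs_iff[OF X] by blast
      then show ?thesis using down by simp
    next
      case 2
      \<comment> \<open>The reversed arc puts \<open>b\<close> back, so the rise given by
        \<open>up\<close> is read backwards as a drop.\<close>
      then obtain b where "\<tau> \<in> X" "b \<in> \<tau> \<inter> ?B" "\<sigma> = \<tau> - {b}"
        unfolding horizontal_arcs_iff[OF X] by blast
      then show ?thesis using up by simp
    qed
  qed
  then show ?thesis
    by (intro no_cycle_if_potential[where f = f]) auto
qed

lemma is_matching_horizontal_arcs_if_dalmatian:
  assumes X: "finite_simplicial_complex X" and d: "dalmatian X v \<epsilon>"
  shows "is_matching (face_poset X) (horizontal_arcs X v \<epsilon>)"
proof -
  have unique: "b = c"
    if "\<sigma> \<in> X" "\<tau> \<in> X" "\<sigma> \<inter> \<tau> \<noteq> {}" "b \<in> \<sigma> \<inter> black v \<epsilon>" "c \<in> \<tau> \<inter> black v \<epsilon>" for \<sigma> \<tau> b c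
  proof -
    have "card ((\<sigma> \<union> \<tau>) \<inter> black v \<epsilon>) \<le> Suc 0"
      using d that by (simp add: dalmatian_def)
    moreover have "finite ((\<sigma> \<union> \<tau>) \<inter> black v \<epsilon>)"
      by (simp add: black_def)
    ultimately show ?thesis
      using that by (auto simp: card_le_Suc0_iff_eq)
  qed
  have "(\<sigma>, \<sigma>') = (\<tau>, \<tau>')"
    if arcs: "(\<sigma>, \<sigma>') \<in> horizontal_arcs X v \<epsilon>" "(\<tau>, \<tau>') \<in> horizontal_arcs X v \<epsilon>"
      and meet: "{\<sigma>, \<sigma>'} \<inter> {\<tau>, \<tau>'} \<noteq> {}" for \<sigma> \<sigma>' \<tau> \<tau>'
  proof -
    obtain b c where b: "\<sigma> \<in> X" "\<sigma>' \<noteq> {}" "b \<in> \<sigma> \<inter> black v \<epsilon>" "\<sigma>' = \<sigma> - {b}"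
      and c: "\<tau> \<in> X" "\<tau>' \<noteq> {}" "c \<in> \<tau> \<inter> black v \<epsilon>" "\<tau>' = \<tau> - {c}"
      using arcs unfolding horizontal_arcs_iff[OF X] by blast
    have endpoints: "\<sigma> = \<tau> \<or> \<sigma> = \<tau>' \<or> \<sigma>' = \<tau> \<or> \<sigma>' = \<tau>'"
      using meet by blast
    \<comment> \<open>In each of the four cases the common endpoint is a nonempty set contained in
      both \<sigma> and \<tau>.\<close>
    have "\<sigma> \<inter> \<tau> \<noteq> {}"
      using endpoints b c by blast
    then have "b = c"
      using unique[OF b(1) c(1) _ b(3) c(3)] by blast
    with b c have "b \<in> \<sigma>" "b \<in> \<tau>" "\<sigma>' = \<sigma> - {b}" "\<tau>' = \<tau> - {b}"
      by blast+
    \<comment> \<open>The mixed cases fail because \<open>b\<close> lies in the larger sets and in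
      neither smaller one; if the smaller sets agree, adding \<open>b\<close> back gives
      equality.\<close>
    then have "\<sigma> = \<tau>"
      using endpoints by blast
    then show ?thesis
      using \<open>b = c\<close> b(4) c(4) by simp
  qed
  then have "{fst e, snd e} \<inter> {fst f, snd f} = {}"
    if "e \<in> horizontal_arcs X v \<epsilon>" "f \<in> horizontal_arcs X v \<epsilon>" "e \<noteq> f" for e f
    using that by (metis prod.collapse)
  moreover have "horizontal_arcs X v \<epsilon> \<subseteq> parcs (face_poset X)"
    unfolding horizontal_arcs_def by blast
  ultimately show ?thesis
    unfolding is_matching_def by blast
qed

text \<open>It suffices to look at arcs from one-dimensional simplices to their vertices, because a
  violation of the dalmatian condition already appears there.\<close>

lemma dalmatian_if_is_matching_horizontal_arcs:
  assumes X: "finite_simplicial_complex X" and "\<epsilon> \<noteq> 0"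
    and m: "is_matching (face_poset X) (horizontal_arcs X v \<epsilon>)"
  shows "dalmatian X v \<epsilon>"
proof -
  have sub: "\<rho> \<in> X" if "\<sigma> \<in> X" "\<rho> \<subseteq> \<sigma>" for \<rho> \<sigma>
    using that X unfolding finite_simplicial_complex_def by blast
  have arc: "({b, w}, {w}) \<in> horizontal_arcs X v \<epsilon>"
    if "{b, w} \<in> X" "b \<in> black v \<epsilon>" "b \<noteq> w" for b w
    using that unfolding horizontal_arcs_iff[OF X] by auto
  have disjoint: "(\<sigma>, \<sigma>') = (\<tau>, \<tau>')"
    if "(\<sigma>, \<sigma>') \<in> horizontal_arcs X v \<epsilon>" "(\<tau>, \<tau>') \<in> horizontal_arcs X v \<epsilon>"
      "\<sigma> = \<tau> \<or> \<sigma>' = \<tau>'" for \<sigma> \<sigma>' \<tau> \<tau>'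
  proof (rule ccontr)
    assume "(\<sigma>, \<sigma>') \<noteq> (\<tau>, \<tau>')"
    then have "{\<sigma>, \<sigma>'} \<inter> {\<tau>, \<tau>'} = {}"
      using m that(1,2) unfolding is_matching_def by (metis fst_conv snd_conv)
    with that(3) show False by blast
  qed
  \<comment> \<open>Otherwise two different arcs leave the same source
    \<open>{b, c}\<close>.\<close>
  have one_simplex: "b = c" if "{b, c} \<in> X" "b \<in> black v \<epsilon>" "c \<in> black v \<epsilon>" for b c
  proof (rule ccontr)
    assume "b \<noteq> c"
    then have "({b, c}, {c}) = ({c, b}, {b})"
      using that by (intro disjoint arc) (auto simp: insert_commute)
    with \<open>b \<noteq> c\<close> show False by auto
  qed
  have common_vertex: "b = c"
    if "{b, w} \<in> X" "{c, w} \<in> X" "b \<in> black v \<epsilon>" "c \<in> black v \<epsilon>" for b c w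
  \<comment> \<open>If \<open>w\<close> is \<open>b\<close> or \<open>c\<close>, one of the two
    simplices is \<open>{b, c}\<close> itself; otherwise two arcs share the target
    \<open>{w}\<close>.\<close>
  proof (cases "b = w \<or> c = w")
    case True
    then show ?thesis
      using that one_simplex[of b c] by (auto simp: insert_commute)
  next
    case False
    then have "({b, w}, {w}) = ({c, w}, {w})"
      using that by (intro disjoint arc) auto
    with False show ?thesis by (auto simp: doubleton_eq_iff)
  qed
  have "card ((\<sigma> \<union> \<tau>) \<inter> black v \<epsilon>) \<le> 1" if st: "\<sigma> \<in> X" "\<tau> \<in> X" "\<sigma> \<inter> \<tau> \<noteq> {}" for \<sigma> \<tau>
  proof -
    obtain w where w: "w \<in> \<sigma>" "w \<in> \<tau>" using st by blast
    \<comment> \<open>As \<open>w\<close> lies in both simplices, the pair is contained in whichever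
      of them contains \<open>b\<close>.\<close>
    have "{b, w} \<in> X" if "b \<in> \<sigma> \<union> \<tau>" for b
      using that w sub[OF st(1), of "{b, w}"] sub[OF st(2), of "{b, w}"] by auto
    then have "\<forall>b \<in> (\<sigma> \<union> \<tau>) \<inter> black v \<epsilon>. \<forall>c \<in> (\<sigma> \<union> \<tau>) \<inter> black v \<epsilon>. b = c"
      using common_vertex by blast
    moreover have "finite ((\<sigma> \<union> \<tau>) \<inter> black v \<epsilon>)"
      by (simp add: black_def)
    ultimately show ?thesis
      by (simp add: card_le_Suc0_iff_eq)
  qed
  then show ?thesis
    using \<open>\<epsilon> \<noteq> 0\<close> by (simp add: dalmatian_def)
qed

theorem theorem3p4:
  fixes X :: "'a set set"
    and v :: "'n::finite \<Rightarrow> 'a"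
    and \<epsilon> :: "bit ^ 'n"
  assumes "finite_simplicial_complex X"
    and "inj v" and "range v = vertices X"
    and "\<epsilon> \<noteq> 0"
  shows "morse_matching X (horizontal_arcs X v \<epsilon>) \<longleftrightarrow> dalmatian X v \<epsilon>"
  using reverse_horizontal_arcs_acyclic[OF assms(1)]
    is_matching_horizontal_arcs_if_dalmatian[OF assms(1)]
    dalmatian_if_is_matching_horizontal_arcs[OF assms(1,4)]
  unfolding morse_matching_def by blast

end
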